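(* For the Poisson distribution with parameter $\lambda>0$, with entropies $\mathbf H_{SH}(\lambda)$, $\mathbf H_R(\alpha,\lambda)$, $\mathbf H_T(\alpha,\lambda)$, $\mathbf H_{SM}(\alpha,\beta,\lambda)$ (see context): (i) The Shannon entropy $\mathbf H_{SH}(\lambda)$ is strictly increasing and concave as a function of $\lambda\in(0,\infty)$. (ii) For any $\alpha\in(0,1)\cup(1,\infty)$, the Rényi entropy $\mathbf H_R(\alpha,\lambda)$ strictly increases as a function of $\lambda\in(0,\infty)$. (iii) For any $\alpha\in(0,1)\cup(1,\infty)$, the Tsallis entropy $\mathbf H_T(\alpha,\lambda)$ strictly increases as a function of $\lambda\in(0,\infty)$. (iv) For any $\alpha,\beta\in(0,1)\cup(1,\infty)$, the Sharma--Mittal entropy $\mathbf H_{SM}(\alpha,\beta,\lambda)$ strictly increases as a function of $\lambda\in(0,\infty)$.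
   Context: For $\lambda>0$ let $p_i(\lambda)=e^{-\lambda}\lambda^i/i!$, $i\ge0$ (Poisson distribution); $\log$ is the natural logarithm. Then $\mathbf H_{SH}(\lambda)=-\sum_{i\ge0}p_i(\lambda)\log p_i(\lambda)$; $\mathbf H_R(\alpha,\lambda)=\frac1{1-\alpha}\log\sum_{i\ge0}p_i(\lambda)^\alpha$ for $\alpha>0$, $\alpha\neq1$; $\mathbf H_T(\alpha,\lambda)=\frac1{1-\alpha}\bigl(\sum_{i\ge0}p_i(\lambda)^\alpha-1\bigr)$ for $\alpha>0$, $\alpha\ne1$; $\mathbf H_{SM}(\alpha,\beta,\lambda)=\frac1{1-\beta}\Bigl(\bigl(\sum_{i\ge0}p_i(\lambda)^\alpha\bigr)^{\frac{1-\beta}{1-\alpha}}-1\Bigr)$ for $\alpha,\beta>0$, $\alpha\neq1$, $\beta\ne1$. *)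

theory Defs
  imports "HOL-Probability.Probability"
begin

abbreviation poisson_prob :: "real \<Rightarrow> nat \<Rightarrow> real" where
  "poisson_prob l i \<equiv> pmf (poisson_pmf l) i"

lemma poisson_prob_eq: "0 < l \<Longrightarrow> poisson_prob l i = exp (- l) * l ^ i / fact i"
  by simp

definition shannon_entropy :: "real \<Rightarrow> real" where
  "shannon_entropy l = - (\<Sum>i. poisson_prob l i * ln (poisson_prob l i))"

definition renyi_entropy :: "real \<Rightarrow> real \<Rightarrow> real" where
  "renyi_entropy \<alpha> l = 1 / (1 - \<alpha>) * ln (\<Sum>i. poisson_prob l i powr \<alpha>)"

definition tsallis_entropy :: "real \<Rightarrow> real \<Rightarrow> real" where
  "tsallis_entropy \<alpha> l = 1 / (1 - \<alpha>) * ((\<Sum>i. poisson_prob l i powr \<alpha>) - 1)"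

definition sharma_mittal_entropy :: "real \<Rightarrow> real \<Rightarrow> real \<Rightarrow> real" where
  "sharma_mittal_entropy \<alpha> \<beta> l =
     1 / (1 - \<beta>) * ((\<Sum>i. poisson_prob l i powr \<alpha>) powr ((1 - \<beta>) / (1 - \<alpha>)) - 1)"

text \<open>
  Both series converge for every positive rate, so the uses of \<^const>\<open>suminf\<close> above
  denote genuine sums on the parameter range of interest.
\<close>

lemma summable_poisson_powr:
  assumes l: "0 < l" and a: "0 < \<alpha>"
  shows "summable (\<lambda>i. poisson_prob l i powr \<alpha>)"
proof -
  define c :: real where "c = (1/2) powr \<alpha>"
  have c: "c < 1" using powr_less_mono2[of \<alpha> "1/2" 1] a by (simp add: c_def)
  obtain N :: nat where N: "2 * l \<le> real N" using real_arch_simple by blast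
  show ?thesis
  proof (rule summable_ratio_test[OF c, of N])
    fix n assume n: "n \<ge> N"
    have "2 * l \<le> real (Suc n)" using N n by linarith
    then have q: "l / real (Suc n) \<le> 1/2" by (simp add: field_simps)
    have "poisson_prob l (Suc n) = l / real (Suc n) * poisson_prob l n"
      using l by (simp add: field_simps)
    also have "\<dots> \<le> 1/2 * poisson_prob l n"
      using q by (rule mult_right_mono) simp
    finally have "poisson_prob l (Suc n) powr \<alpha> \<le> (1/2 * poisson_prob l n) powr \<alpha>"
      using a by (intro powr_mono2) auto
    also have "\<dots> = c * poisson_prob l n powr \<alpha>"
      unfolding c_def by (rule powr_mult)
    finally show "norm (poisson_prob l (Suc n) powr \<alpha>) \<le> c * norm (poisson_prob l n powr \<alpha>)"
      by simp
  qed
qed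

lemma summable_poisson_ln:
  assumes l: "0 < l"
  shows "summable (\<lambda>i. poisson_prob l i * ln (poisson_prob l i))"
proof (rule summable_comparison_test')
  show "summable (\<lambda>i. 2 * poisson_prob l i powr (1/2))"
    using l by (intro summable_mult summable_poisson_powr) auto
  fix i :: nat
  define x where "x = poisson_prob l i"
  have x0: "0 < x" using l by (simp add: x_def)
  have x1: "x \<le> 1" by (simp add: x_def pmf_le_1)
  define s where "s = sqrt x"
  have s0: "0 < s" and xs: "x = s * s" using x0 by (auto simp: s_def)
  have "ln (1 / s) \<le> 1 / s" using ln_le_minus_one[of "1 / s"] s0 by simp
  then have "s * s * (- ln s) \<le> s * s * (1 / s)"
    using s0 by (intro mult_left_mono) (auto simp: ln_div)
  then have "- (x * ln x) \<le> 2 * s" using s0 by (simp add: xs ln_mult)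
  moreover have "x * ln x \<le> 0" using x0 x1 by (simp add: mult_nonneg_nonpos)
  ultimately have "\<bar>x * ln x\<bar> \<le> 2 * x powr (1/2)"
    using x0 by (simp add: s_def powr_half_sqrt)
  then show "norm (poisson_prob l i * ln (poisson_prob l i)) \<le> 2 * poisson_prob l i powr (1/2)"
    by (simp only: x_def real_norm_def)
qed

end

(*
  A Poisson variable of rate l + m is the sum of independent Poisson variables of rates l and m, so
  each p_k(l + m) is a combination of p_0(l), ..., p_k(l) with weights p_k(m), ..., p_0(m) of total
  mass < 1. If phi is convex and phi (t x) < t phi x for 0 < t < 1, Jensen's inequality bounds
  phi (p_k(l + m)) strictly by the same combination of the phi (p_j(l)), and summing over k shows
  that the sum of the phi (p_k(l)) strictly decreases in l. The choices x ln x, x^a (a > 1) and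
  - x^a (a < 1) for phi give all the monotonicity statements; the Renyi, Tsallis and Sharma-Mittal
  entropies are increasing functions of (sum p_k^a)^(1/(1-a)).

  For concavity, H(l) = l - l ln l + E ln (X!), and d/dl E f(X) = E (f(X + 1) - f(X)), whence
  H''(l) = - 1/l + E ln ((X + 2)/(X + 1)) <= - 1/l + E (1/(X + 1)) = - exp (- l)/l <= 0.
*)
theory Submission
  imports Defs
begin

section \<open>Monotonicity\<close>

lemma poisson_prob_pos: "0 < l \<Longrightarrow> 0 < poisson_prob l i"
  by simp

lemma sums_poisson_prob:
  assumes "0 < l"
  shows "poisson_prob l sums 1"
proof -
  have "(\<lambda>n. exp (- l) * (l ^ n /\<^sub>R fact n)) sums (exp (- l) * exp l)"
    by (intro sums_mult exp_converges)
  moreover have "exp (- l) * (l ^ n /\<^sub>R fact n) = poisson_prob l n" for n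
    using assms by (simp add: field_simps)
  ultimately show ?thesis
    by (simp add: exp_minus)
qed

text \<open>This is the binomial theorem for (m + l)^k. The index order matches the k-th Cauchy
  product coefficient used in \<open>suminf_poisson_strict_antimono\<close>.\<close>

lemma poisson_prob_add:
  assumes "0 < l" "0 < m"
  shows "poisson_prob (l + m) k = (\<Sum>i\<le>k. poisson_prob m i * poisson_prob l (k - i))"
proof -
  have "(\<Sum>i\<le>k. poisson_prob m i * poisson_prob l (k - i))
      = (\<Sum>i\<le>k. exp (- (l + m)) / fact k * (of_nat (k choose i) * m ^ i * l ^ (k - i)))"
    using assms by (intro sum.cong) (auto simp: binomial_fact exp_add exp_diff exp_minus field_simps)
  also have "\<dots> = exp (- (l + m)) / fact k * (m + l) ^ k"
    by (simp only: binomial_ring sum_distrib_left)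
  also have "\<dots> = poisson_prob (l + m) k"
    using assms by (simp add: add.commute)
  finally show ?thesis ..
qed

text \<open>Dividing the weights by their mass W gives a genuine mean y, to which ordinary Jensen
  applies. The strictness comes from \<open>star\<close> with t = W, so convexity itself may be
  non-strict.\<close>

lemma jensen_subprobability_strict:
  fixes \<phi> :: "real \<Rightarrow> real"
  assumes conv: "convex_on {0<..} \<phi>"
    and star: "\<And>t x. 0 < t \<Longrightarrow> t < 1 \<Longrightarrow> 0 < x \<Longrightarrow> \<phi> (t * x) < t * \<phi> x"
    and fin: "finite S" "S \<noteq> {}"
    and w: "\<And>i. i \<in> S \<Longrightarrow> 0 < w i" "sum w S < 1"
    and x: "\<And>i. i \<in> S \<Longrightarrow> 0 < x i"
  shows "\<phi> (\<Sum>i\<in>S. w i * x i) < (\<Sum>i\<in>S. w i * \<phi> (x i))"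
proof -
  define W where "W = sum w S"
  have W: "0 < W" "W < 1"
    using fin w by (auto simp: W_def intro: sum_pos)
  define y where "y = (\<Sum>i\<in>S. (w i / W) *\<^sub>R x i)"
  have y: "0 < y"
    unfolding y_def using fin w W x by (intro sum_pos) auto
  have "(\<Sum>i\<in>S. w i * x i) = W * y"
    using W by (simp add: y_def sum_distrib_left)
  then have "\<phi> (\<Sum>i\<in>S. w i * x i) < W * \<phi> y"
    using star[OF W y] by simp
  also have "\<phi> y \<le> (\<Sum>i\<in>S. w i / W * \<phi> (x i))"
    unfolding y_def using fin conv w W x
    by (intro convex_on_sum[OF fin conv]) (auto simp: less_imp_le simp flip: sum_divide_distrib W_def)
  then have "W * \<phi> y \<le> W * (\<Sum>i\<in>S. w i / W * \<phi> (x i))"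
    using W by (intro mult_left_mono) auto
  also have "\<dots> = (\<Sum>i\<in>S. w i * \<phi> (x i))"
    using W by (simp add: sum_distrib_left)
  finally show ?thesis .
qed

lemma suminf_poisson_strict_antimono:
  fixes \<phi> :: "real \<Rightarrow> real"
  assumes conv: "convex_on {0<..} \<phi>"
    and star: "\<And>t x. 0 < t \<Longrightarrow> t < 1 \<Longrightarrow> 0 < x \<Longrightarrow> \<phi> (t * x) < t * \<phi> x"
    and summ: "\<And>l. 0 < l \<Longrightarrow> summable (\<lambda>i. \<bar>\<phi> (poisson_prob l i)\<bar>)"
    and l: "0 < l" "l < l'"
  shows "(\<Sum>i. \<phi> (poisson_prob l' i)) < (\<Sum>i. \<phi> (poisson_prob l i))"
proof -
  define m where "m = l' - l"
  have m: "0 < m" "l' = l + m"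
    using l by (auto simp: m_def)
  \<comment> \<open>\<open>b\<close> is the Cauchy product of the weights p_i(m) with the values
    \<phi> (p_j(l)). The weights have total mass 1, so \<open>b\<close> has the same sum as those
    values.\<close>
  define b where "b k = (\<Sum>i\<le>k. poisson_prob m i * \<phi> (poisson_prob l (k - i)))" for k
  note p = sums_poisson_prob[OF m(1)]
  have "b sums ((\<Sum>i. poisson_prob m i) * (\<Sum>i. \<phi> (poisson_prob l i)))"
    unfolding b_def using summ[OF l(1)] sums_summable[OF p]
    by (intro Cauchy_product_sums) (simp_all only: real_norm_def abs_of_nonneg[OF pmf_nonneg])
  then have b: "b sums (\<Sum>i. \<phi> (poisson_prob l i))"
    by (simp only: sums_unique[OF p, symmetric] mult_1)
  have less: "\<phi> (poisson_prob l' k) < b k" for k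
  proof -
    \<comment> \<open>Every finite initial segment misses positive mass, which gives the total
      weight < 1 that Jensen's strict form asks for.\<close>
    have "sum (poisson_prob m) {..<Suc k} < suminf (poisson_prob m)"
      using sums_summable[OF p] poisson_prob_pos[OF m(1)] by (intro sum_less_suminf) blast+
    then have "sum (poisson_prob m) {..k} < 1"
      by (simp only: lessThan_Suc_atMost sums_unique[OF p, symmetric])
    then show ?thesis
      unfolding b_def m(2) poisson_prob_add[OF l(1) m(1)]
      using poisson_prob_pos l(1) m(1)
      by (intro jensen_subprobability_strict[OF conv star]) blast+
  qed
  have s: "summable (\<lambda>i. \<phi> (poisson_prob l' i))"
    using l by (intro summable_rabs_cancel[OF summ]) linarith
  have "0 < (\<Sum>k. b k - \<phi> (poisson_prob l' k))"
    using less by (intro suminf_pos summable_diff sums_summable[OF b] s) (simp only: diff_gt_0_iff_gt)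
  also have "\<dots> = (\<Sum>i. \<phi> (poisson_prob l i)) - (\<Sum>i. \<phi> (poisson_prob l' i))"
    using suminf_diff[OF sums_summable[OF b] s] by (simp only: sums_unique[OF b, symmetric])
  finally show ?thesis
    by simp
qed

section \<open>Monotonicity of the power sums in the rate\<close>

lemma convex_on_powr:
  fixes \<alpha> :: real
  assumes "1 < \<alpha>"
  shows "convex_on {0<..} (\<lambda>x. x powr \<alpha>)"
  using assms
  by (intro f''_ge0_imp_convex[where f' = "\<lambda>x. \<alpha> * x powr (\<alpha> - 1)"
        and f'' = "\<lambda>x. \<alpha> * ((\<alpha> - 1) * x powr (\<alpha> - 1 - 1))"])
    (auto intro!: derivative_eq_intros)

lemma convex_on_minus_powr:
  fixes \<alpha> :: real
  assumes "0 < \<alpha>" "\<alpha> < 1"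
  shows "convex_on {0<..} (\<lambda>x. - (x powr \<alpha>))"
  using assms
  by (intro f''_ge0_imp_convex[where f' = "\<lambda>x. - (\<alpha> * x powr (\<alpha> - 1))"
        and f'' = "\<lambda>x. - (\<alpha> * ((\<alpha> - 1) * x powr (\<alpha> - 1 - 1)))"])
    (auto intro!: derivative_eq_intros simp: mult_le_0_iff)

lemma convex_on_mult_ln: "convex_on {0<..} (\<lambda>x::real. x * ln x)"
  by (intro f''_ge0_imp_convex[where f' = "\<lambda>x. ln x + 1" and f'' = "\<lambda>x. 1 / x"])
    (auto intro!: derivative_eq_intros)

lemma suminf_poisson_powr_pos:
  assumes "0 < l" "0 < \<alpha>"
  shows "0 < (\<Sum>i. poisson_prob l i powr \<alpha>)"
  using assms by (intro suminf_pos summable_poisson_powr) auto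

lemma suminf_poisson_powr_less:
  assumes a: "1 < \<alpha>" and l: "0 < l" "l < l'"
  shows "(\<Sum>i. poisson_prob l' i powr \<alpha>) < (\<Sum>i. poisson_prob l i powr \<alpha>)"
proof (rule suminf_poisson_strict_antimono[OF convex_on_powr[OF a] _ _ l])
  fix t x :: real
  assume tx: "0 < t" "t < 1" "0 < x"
  \<comment> \<open>Since powers are multiplicative, the scaling condition reduces to t^\<alpha> <
    t.\<close>
  have "t powr \<alpha> < t powr 1"
    using tx a by (intro powr_less_mono') auto
  then show "(t * x) powr \<alpha> < t * x powr \<alpha>"
    using tx by (simp add: powr_mult)
next
  fix l :: real
  assume "0 < l"
  then show "summable (\<lambda>i. \<bar>poisson_prob l i powr \<alpha>\<bar>)"
    using summable_poisson_powr[of l \<alpha>] a by (simp only: abs_of_nonneg[OF powr_ge_zero])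
qed

lemma suminf_poisson_powr_greater:
  assumes a: "0 < \<alpha>" "\<alpha> < 1" and l: "0 < l" "l < l'"
  shows "(\<Sum>i. poisson_prob l i powr \<alpha>) < (\<Sum>i. poisson_prob l' i powr \<alpha>)"
proof -
  \<comment> \<open>For \<alpha> < 1 the power is concave, so the comparison is applied to its
    negative.\<close>
  have "(\<Sum>i. - (poisson_prob l' i powr \<alpha>)) < (\<Sum>i. - (poisson_prob l i powr \<alpha>))"
  proof (rule suminf_poisson_strict_antimono[OF convex_on_minus_powr[OF a] _ _ l])
    fix t x :: real
    assume tx: "0 < t" "t < 1" "0 < x"
    have "t powr 1 < t powr \<alpha>"
      using tx a by (intro powr_less_mono') auto
    then show "- ((t * x) powr \<alpha>) < t * - (x powr \<alpha>)"
      using tx by (simp add: powr_mult)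
  next
    fix l :: real
    assume "0 < l"
    then show "summable (\<lambda>i. \<bar>- (poisson_prob l i powr \<alpha>)\<bar>)"
      using summable_poisson_powr[of l \<alpha>] a
      by (simp only: abs_minus_cancel abs_of_nonneg[OF powr_ge_zero])
  qed
  then show ?thesis
    using summable_poisson_powr a l by (subst (asm) (1 2) suminf_minus) auto
qed

text \<open>The exponent 1/(1 - \<alpha>) changes sign at \<alpha> = 1 exactly where the power sum
  changes its direction of monotonicity, so the result increases in both cases. It is the
  exponential of the Renyi entropy.\<close>

lemma suminf_poisson_powr_root_less:
  assumes a: "\<alpha> \<in> {0<..<1} \<union> {1<..}" and l: "0 < l" "l < l'"
  shows "(\<Sum>i. poisson_prob l i powr \<alpha>) powr (1 / (1 - \<alpha>))
    < (\<Sum>i. poisson_prob l' i powr \<alpha>) powr (1 / (1 - \<alpha>))"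
proof (cases "\<alpha> < 1")
  case True
  then show ?thesis
    using a l suminf_poisson_powr_greater suminf_poisson_powr_pos
    by (intro powr_less_mono2) (auto simp: less_imp_le)
next
  case False
  then show ?thesis
    using a l suminf_poisson_powr_less[of \<alpha> l l'] suminf_poisson_powr_pos[of l' \<alpha>]
    by (intro powr_less_mono2_neg) auto
qed

section \<open>Monotonicity of the four entropies\<close>

lemma sharma_mittal_entropy_strict_mono:
  assumes a: "\<alpha> \<in> {0<..<1} \<union> {1<..}" and b: "\<beta> \<noteq> 1"
  shows "strict_mono_on {0<..} (\<lambda>l. sharma_mittal_entropy \<alpha> \<beta> l)"
proof (rule strict_mono_onI)
  fix l l' :: real
  assume "l \<in> {0<..}" "l' \<in> {0<..}" and ll': "l < l'"
  then have l: "0 < l" "0 < l'"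
    by auto
  \<comment> \<open>In terms of \<open>T\<close> the entropy is (T^(1 - \<beta>) - 1)/(1 - \<beta>),
    which increases in T > 0 for either sign of 1 - \<beta>.\<close>
  define T where "T x = (\<Sum>i. poisson_prob x i powr \<alpha>) powr (1 / (1 - \<alpha>))" for x
  have SM: "sharma_mittal_entropy \<alpha> \<beta> x = 1 / (1 - \<beta>) * (T x powr (1 - \<beta>) - 1)" for x
    by (simp add: sharma_mittal_entropy_def T_def powr_powr)
  have T: "0 < T l" "T l < T l'"
    using suminf_poisson_powr_pos[of l \<alpha>] suminf_poisson_powr_root_less[OF a l(1) ll'] a l
    by (auto simp: T_def)
  show "sharma_mittal_entropy \<alpha> \<beta> l < sharma_mittal_entropy \<alpha> \<beta> l'"
  proof (cases "\<beta> < 1")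
    case True
    then have "T l powr (1 - \<beta>) < T l' powr (1 - \<beta>)"
      using T by (intro powr_less_mono2) auto
    then show ?thesis
      using True unfolding SM by (intro mult_strict_left_mono) auto
  next
    case False
    then have "T l' powr (1 - \<beta>) < T l powr (1 - \<beta>)"
      using T b by (intro powr_less_mono2_neg) auto
    then show ?thesis
      using False b unfolding SM by (intro mult_strict_left_mono_neg) auto
  qed
qed

lemma tsallis_entropy_strict_mono:
  assumes a: "\<alpha> \<in> {0<..<1} \<union> {1<..}"
  shows "strict_mono_on {0<..} (\<lambda>l. tsallis_entropy \<alpha> l)"
proof -
  \<comment> \<open>On the diagonal \<beta> = \<alpha> the outer exponent is 1; positivity of the
    sum allows \<open>powr\<close> 1 to be dropped.\<close>
  have "tsallis_entropy \<alpha> l = sharma_mittal_entropy \<alpha> \<alpha> l" if "l \<in> {0<..}" for l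
    using suminf_poisson_powr_pos[of l \<alpha>] a that
    by (auto simp: tsallis_entropy_def sharma_mittal_entropy_def simp del: pmf_poisson)
  then show ?thesis
    using sharma_mittal_entropy_strict_mono[OF a, of \<alpha>] a by (auto simp: monotone_on_def)
qed

lemma renyi_entropy_strict_mono:
  assumes a: "\<alpha> \<in> {0<..<1} \<union> {1<..}"
  shows "strict_mono_on {0<..} (\<lambda>l. renyi_entropy \<alpha> l)"
proof (rule strict_mono_onI)
  fix l l' :: real
  assume "l \<in> {0<..}" "l' \<in> {0<..}" and ll': "l < l'"
  then have l: "0 < l" "0 < l'"
    by auto
  define S where "S x = (\<Sum>i. poisson_prob x i powr \<alpha>)" for x
  have S: "0 < S l" "0 < S l'"
    using suminf_poisson_powr_pos[of _ \<alpha>] a l by (auto simp: S_def)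
  \<comment> \<open>The logarithm of this root is the Renyi entropy.\<close>
  have "ln (S l powr (1 / (1 - \<alpha>))) < ln (S l' powr (1 / (1 - \<alpha>)))"
    using suminf_poisson_powr_root_less[OF a l(1) ll'] S
    by (subst ln_less_cancel_iff) (simp_all add: S_def del: pmf_poisson)
  then show "renyi_entropy \<alpha> l < renyi_entropy \<alpha> l'"
    using S by (simp add: renyi_entropy_def ln_powr flip: S_def)
qed

lemma shannon_entropy_strict_mono: "strict_mono_on {0<..} shannon_entropy"
proof (rule strict_mono_onI)
  fix l l' :: real
  assume "l \<in> {0<..}" "l' \<in> {0<..}" and ll': "l < l'"
  then have l: "0 < l"
    by auto
  have "(\<Sum>i. poisson_prob l' i * ln (poisson_prob l' i))
      < (\<Sum>i. poisson_prob l i * ln (poisson_prob l i))"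
  proof (rule suminf_poisson_strict_antimono[OF convex_on_mult_ln _ _ l ll'])
    fix t x :: real
    assume "0 < t" "t < 1" "0 < x"
    \<comment> \<open>The two sides differ by t x ln t < 0.\<close>
    then show "t * x * ln (t * x) < t * (x * ln x)"
      by (simp add: ln_mult algebra_simps mult_less_0_iff)
  next
    fix l :: real
    assume l: "0 < l"
    \<comment> \<open>All terms have one sign because probabilities are at most 1, so summability is
      already absolute.\<close>
    have "poisson_prob l i * ln (poisson_prob l i) \<le> 0" for i
      using poisson_prob_pos[OF l, of i] pmf_le_1[of "poisson_pmf l" i]
      by (intro mult_nonneg_nonpos) (simp_all del: pmf_poisson)
    then have "\<bar>poisson_prob l i * ln (poisson_prob l i)\<bar>
        = - (poisson_prob l i * ln (poisson_prob l i))" for i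
      by (rule abs_of_nonpos)
    then show "summable (\<lambda>i. \<bar>poisson_prob l i * ln (poisson_prob l i)\<bar>)"
      using summable_minus[OF summable_poisson_ln[OF l]] by (simp only:)
  qed
  then show "shannon_entropy l < shannon_entropy l'"
    by (simp add: shannon_entropy_def del: pmf_poisson)
qed

section \<open>Concavity\<close>

text \<open>With c n = f(n)/n! the function is E f(X) for X Poisson of rate x > 0, and
  \<open>diffs c n - c n\<close> is (f(n + 1) - f(n))/n!. This is the rule d/dx E f(X) = E (f(X + 1)
  - f(X)).\<close>

lemma has_real_derivative_exp_minus_powser:
  fixes c :: "nat \<Rightarrow> real"
  assumes c: "\<And>y. summable (\<lambda>n. c n * y ^ n)"
  shows "((\<lambda>x. exp (- x) * (\<Sum>n. c n * x ^ n)) has_real_derivative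
      exp (- x) * (\<Sum>n. (diffs c n - c n) * x ^ n)) (at x)"
proof -
  have "(\<Sum>n. (diffs c n - c n) * x ^ n) = (\<Sum>n. diffs c n * x ^ n) - (\<Sum>n. c n * x ^ n)"
    unfolding left_diff_distrib by (intro suminf_diff[symmetric] termdiff_converges_all c)
  then show ?thesis
    by (auto intro!: derivative_eq_intros termdiffs_strong_converges_everywhere[OF c]
        simp: right_diff_distrib)
qed

text \<open>This lets the derivative rule be iterated.\<close>

lemma summable_diffs_minus:
  fixes c :: "nat \<Rightarrow> real"
  assumes c: "\<And>y. summable (\<lambda>n. c n * y ^ n)"
  shows "summable (\<lambda>n. (diffs c n - c n) * y ^ n)"
  unfolding left_diff_distrib by (intro summable_diff termdiff_converges_all c)

text \<open>A crude bound suffices: geometric growth of the numerators only rescales the argument of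
  the exponential series used for comparison.\<close>

lemma ln_fact_le_two_power: "ln (fact n) \<le> (2::real) ^ n"
proof (induction n)
  case (Suc n)
  have "ln (1 + real n) \<le> real n"
    by (intro ln_add_one_self_le_self) auto
  also have "\<dots> \<le> 2 ^ n"
    using of_nat_less_two_power[of n, where 'a = real] by simp
  finally show ?case
    using Suc by (simp add: ln_mult)
qed simp

lemma summable_ln_fact_powser:
  fixes y :: real
  shows "summable (\<lambda>n. ln (fact n) / fact n * y ^ n)"
proof (rule summable_comparison_test')
  show "summable (\<lambda>n. inverse (fact n) * (2 * \<bar>y\<bar>) ^ n)"
    by (rule summable_exp)
  show "norm (ln (fact n) / fact n * y ^ n) \<le> inverse (fact n) * (2 * \<bar>y\<bar>) ^ n" for n
  proof -
    have "\<bar>ln (fact n :: real)\<bar> = ln (fact n)"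
      by (simp add: fact_ge_1)
    then show ?thesis
      using mult_right_mono[OF ln_fact_le_two_power[of n], of "\<bar>y\<bar> ^ n / fact n"]
      by (simp add: abs_mult power_abs power_mult_distrib field_simps)
  qed
qed

section \<open>Closed form and second derivative of the Shannon entropy\<close>

lemma shannon_entropy_eq:
  assumes l: "0 < l"
  shows "shannon_entropy l = l - l * ln l + exp (- l) * (\<Sum>n. ln (fact n) / fact n * l ^ n)"
proof -
  have mean: "(\<lambda>n. real n * poisson_prob l n) sums l"
  proof -
    have "(\<lambda>n. l * poisson_prob l n) sums (l * 1)"
      by (intro sums_mult sums_poisson_prob l)
    moreover have "l * poisson_prob l n = real (Suc n) * poisson_prob l (Suc n)" for n
      using l by (simp add: field_simps del: of_nat_Suc)
    ultimately have "(\<lambda>n. real (Suc n) * poisson_prob l (Suc n)) sums l"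
      by (simp only: mult_1_right)
    then show ?thesis
      \<comment> \<open>Undoing the shift adds only the term at n = 0, which vanishes.\<close>
      by (subst (asm) sums_Suc_iff) simp
  qed
  have ln_p: "poisson_prob l n * ln (poisson_prob l n) = ln l * (real n * poisson_prob l n)
      - l * poisson_prob l n - exp (- l) * (ln (fact n) / fact n * l ^ n)" for n
  proof -
    have 1: "ln (poisson_prob l n) = real n * ln l - ln (fact n) - l"
      using l by (simp add: ln_mult ln_div ln_realpow)
    have 2: "exp (- l) * (ln (fact n) / fact n * l ^ n) = poisson_prob l n * ln (fact n)"
      using l by simp
    show ?thesis
      unfolding 1 2 by (simp only: algebra_simps)
  qed
  have "(\<lambda>n. poisson_prob l n * ln (poisson_prob l n)) sums
      (ln l * l - l * 1 - exp (- l) * (\<Sum>n. ln (fact n) / fact n * l ^ n))"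
    unfolding ln_p
    by (intro sums_diff sums_mult mean sums_poisson_prob l summable_sums summable_ln_fact_powser)
  then show ?thesis
    unfolding shannon_entropy_def by (simp add: sums_iff del: pmf_poisson)
qed

lemma concave_on_shannon_entropy: "concave_on {0<..} shannon_entropy"
proof -
  \<comment> \<open>\<open>c\<close>, \<open>d\<close> and \<open>e\<close> are the coefficients
    f(n)/n! for f(n) = ln n! and its first two forward differences, ln (n + 1) and ln ((n + 2)/(n +
    1)).\<close>
  define c :: "nat \<Rightarrow> real" where "c n = ln (fact n) / fact n" for n
  define d where "d n = diffs c n - c n" for n
  define e where "e n = diffs d n - d n" for n
  have c: "summable (\<lambda>n. c n * y ^ n)" for y
    unfolding c_def by (rule summable_ln_fact_powser)
  have d: "summable (\<lambda>n. d n * y ^ n)" for y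
    unfolding d_def by (rule summable_diffs_minus[OF c])
  have e: "summable (\<lambda>n. e n * y ^ n)" for y
    unfolding e_def by (rule summable_diffs_minus[OF d])
  have d_eq: "d n = ln (real n + 1) / fact n" for n
  proof -
    have "diffs c n = ln (fact (Suc n)) / fact n"
      by (simp add: c_def diffs_def del: of_nat_Suc)
    then show ?thesis
      by (simp add: d_def c_def ln_mult add.commute flip: diff_divide_distrib)
  qed
  have e_le: "e n \<le> 1 / fact (Suc n)" for n
  proof -
    have "diffs d n = ln (real n + 2) / fact n"
      by (simp add: d_eq diffs_def add.commute del: of_nat_Suc)
    then have "e n = (ln (real n + 2) - ln (real n + 1)) / fact n"
      by (simp add: e_def d_eq diff_divide_distrib)
    also have "\<dots> = ln ((real n + 2) / (real n + 1)) / fact n"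
      by (subst ln_div) auto
    also have "\<dots> = ln (1 + 1 / (real n + 1)) / fact n"
      by (simp add: field_simps)
    \<comment> \<open>Here ln (1 + u) \<le> u with u = 1/(n + 1), and (n + 1) n! = (n + 1)!.\<close>
    also have "\<dots> \<le> 1 / (real n + 1) / fact n"
      by (intro divide_right_mono ln_add_one_self_le_self) auto
    finally show ?thesis
      by (simp add: add.commute)
  qed
  have E: "exp (- l) * (\<Sum>n. e n * l ^ n) \<le> 1 / l" if l: "0 < l" for l
  proof -
    have s: "summable (\<lambda>n. inverse (fact (Suc n)) *\<^sub>R l ^ Suc n)"
      using summable_exp_generic[of l] by (subst summable_Suc_iff)
    \<comment> \<open>The factor l turns the bound for \<open>e\<close> into the exponential series
      without its constant term, hence at most exp l.\<close>
    have "l * (\<Sum>n. e n * l ^ n) = (\<Sum>n. l * (e n * l ^ n))"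
      by (rule suminf_mult[OF e, symmetric])
    also have "\<dots> \<le> (\<Sum>n. inverse (fact (Suc n)) *\<^sub>R l ^ Suc n)"
    proof (intro suminf_le summable_mult e s)
      fix n
      have "e n * l ^ Suc n \<le> 1 / fact (Suc n) * l ^ Suc n"
        using l e_le by (intro mult_right_mono) auto
      then show "l * (e n * l ^ n) \<le> inverse (fact (Suc n)) *\<^sub>R l ^ Suc n"
        by (simp add: field_simps)
    qed
    also have "\<dots> \<le> exp l"
      using exp_first_term[of l] by simp
    finally show ?thesis
      using l by (simp add: exp_minus field_simps)
  qed
  show ?thesis
  proof (rule f''_le0_imp_concave)
    fix x :: real
    assume x: "x \<in> {0<..}"
    have "((\<lambda>l. l - l * ln l + exp (- l) * (\<Sum>n. c n * l ^ n)) has_real_derivative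
        - ln x + exp (- x) * (\<Sum>n. d n * x ^ n)) (at x)"
      using x unfolding d_def
      by (intro DERIV_add has_real_derivative_exp_minus_powser[OF c])
        (auto intro!: derivative_eq_intros)
    \<comment> \<open>The closed form is available only for positive rates, so the derivative is
      transferred within the open half-line.\<close>
    then show "(shannon_entropy has_real_derivative
        - ln x + exp (- x) * (\<Sum>n. d n * x ^ n)) (at x)"
      by (rule has_field_derivative_transform_within_open[OF _ open_greaterThan x])
        (simp add: shannon_entropy_eq c_def)
    show "((\<lambda>x. - ln x + exp (- x) * (\<Sum>n. d n * x ^ n)) has_real_derivative
        - (1 / x) + exp (- x) * (\<Sum>n. e n * x ^ n)) (at x)"
      using x unfolding e_def
      by (intro DERIV_add has_real_derivative_exp_minus_powser[OF d])
        (auto intro!: derivative_eq_intros)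
    show "- (1 / x) + exp (- x) * (\<Sum>n. e n * x ^ n) \<le> 0"
      using E[of x] x by simp
  qed simp
qed

theorem proposition5p1:
  shows "(strict_mono_on {0<..} shannon_entropy \<and> concave_on {0<..} shannon_entropy)
    \<and> (\<forall>\<alpha> \<in> {0<..<1} \<union> {1<..}. strict_mono_on {0<..} (\<lambda>l. renyi_entropy \<alpha> l))
    \<and> (\<forall>\<alpha> \<in> {0<..<1} \<union> {1<..}. strict_mono_on {0<..} (\<lambda>l. tsallis_entropy \<alpha> l))
    \<and> (\<forall>\<alpha> \<in> {0<..<1} \<union> {1<..}. \<forall>\<beta> \<in> {0<..<1} \<union> {1<..}.
         strict_mono_on {0<..} (\<lambda>l. sharma_mittal_entropy \<alpha> \<beta> l))"
proof (intro conjI ballI)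
  show "strict_mono_on {0<..} shannon_entropy"
    by (rule shannon_entropy_strict_mono)
  show "concave_on {0<..} shannon_entropy"
    by (rule concave_on_shannon_entropy)
next
  fix \<alpha> :: real
  assume a: "\<alpha> \<in> {0<..<1} \<union> {1<..}"
  show "strict_mono_on {0<..} (\<lambda>l. renyi_entropy \<alpha> l)"
    using a by (rule renyi_entropy_strict_mono)
  show "strict_mono_on {0<..} (\<lambda>l. tsallis_entropy \<alpha> l)"
    using a by (rule tsallis_entropy_strict_mono)
  fix \<beta> :: real
  assume "\<beta> \<in> {0<..<1} \<union> {1<..}"
  then show "strict_mono_on {0<..} (\<lambda>l. sharma_mittal_entropy \<alpha> \<beta> l)"
    by (intro sharma_mittal_entropy_strict_mono[OF a]) auto
qed

end
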